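(* Let $n,r,t$ be integers with $r\ge1$, $t\ge1$ and $n \geq 2r+2t+2$. Then there is a graph $G$ on $n$ vertices (namely the complete graph $K_n$) such that both the level-$r$ Lovász–Schrijver-SDP tightening $\mathcal N_+^{(r)}(P_t(G))$ and the level-$r$ Sherali–Adams-SDP tightening of $P_t(G)$ have integrality gap at least $\binom{n-2r}{2}/(t\cdot n)$ for the unweighted $t$-Partial-Vertex-Cover objective $\sum_{i\in V}x_i$.
   Context: For a graph $G=(V,E)$ and an integer $t\le |E|$, a $t$-partial vertex cover is a set $S\subseteq V$ such that at least $t$ edges have an endpoint in $S$; the unweighted problem asks for one of minimum size. Its LP relaxation has variables $x_q$, $q\in V\cup E$, objective $\min \sum_{i\in V} x_i$, and constraints: $x_i+x_j\ge x_e$ for every edge $e=\{i,j\}$; $\sum_{e\in E} x_e\ge t$; $0\le x_q\le 1$. Its feasible region is $P_t(G)\subseteq[0,1]^m$, $[m]=V\cup E$. Integrality gap = optimal integral cost divided by optimal relaxation value. Homogenization: for $P\subseteq[0,1]^m$ given by constraints $a^Tx\ge b$, $K$ is the cone of $\bar x\in\mathbb R^{\{\emptyset\}\cup[m]}$ with $\bar x_\emptyset\ge0$ and $a^T\bar x\ge b\bar x_\emptyset$. $\mathcal P_r$ = subsets of $[m]$ of size at most $r$. For $y\in\mathbb R^{\mathcal P_{r+1}}$ the moment matrix $\mathcal Y$ has rows indexed by $\mathcal P_1$, columns by $\mathcal P_r$, $\mathcal Y_{A,B}=y_{A\cup B}$; $\mathbf e_I$ are standard basis vectors. Lovász–Schrijver-SDP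 ($\mathsf{LS}_+$): $K^{(0)}=K$; $K^{(r)}$ is the set of $x\in\mathbb R^{\mathcal P_1}$ for which there exists $y\in\mathbb R^{\mathcal P_2}$ whose (square, $\mathcal P_1\times\mathcal P_1$) moment matrix $\mathcal Y$ is positive semidefinite, $\mathcal Y\mathbf e_\emptyset=x$, and for every $i\in[m]$ both $\mathcal Y\mathbf e_{\{i\}}$ and $\mathcal Y(\mathbf e_\emptyset-\mathbf e_{\{i\}})$ lie in $K^{(r-1)}$. Then $\mathcal N_+^{(r)}(P)=K^{(r)}\cap\{x_\emptyset=1\}$. Sherali–Adams ($\mathsf{SA}$): $M^{(r)}$ is the set of $x\in\mathbb R^{\mathcal P_1}$ for which there is $y\in\mathbb R^{\mathcal P_{r+1}}$ with $\mathcal Y\mathbf e_\emptyset=x$ and $\mathcal Y\sum_{T\subseteq N}(-1)^{|T|}\mathbf e_{Y\cup T}\in K$ for all $Y,N$ with $Y\cup N\in\mathcal P_r$; level-$r$ tightening is $M^{(r)}\cap\{x_\emptyset=1\}$. Sherali–Adams-SDP ($\mathsf{SA}_+$): the same as level-$r$ $\mathsf{SA}$, with the additional requirement that the principal submatrix of $\mathcal Y$ indexed by $\mathcal P_1\times\mathcal P_1$ is positive semidefinite. *)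

theory Defs
  imports "HOL-Analysis.Analysis"
begin

section \<open>Partial vertex cover\<close>

record 'v ugraph =
  verts :: "'v set"
  edges :: "'v set set"

definition simple_graph :: "'v ugraph \<Rightarrow> bool" where
  "simple_graph G \<longleftrightarrow> finite (verts G) \<and> edges G \<subseteq> {e. e \<subseteq> verts G \<and> card e = 2}"

definition complete_graph :: "'v ugraph \<Rightarrow> bool" where
  "complete_graph G \<longleftrightarrow> edges G = {e. e \<subseteq> verts G \<and> card e = 2}"

definition partial_vertex_cover :: "nat \<Rightarrow> 'v ugraph \<Rightarrow> 'v set \<Rightarrow> bool" where
  "partial_vertex_cover t G S \<longleftrightarrow> S \<subseteq> verts G \<and> t \<le> card {e \<in> edges G. e \<inter> S \<noteq> {}}"

text \<open>The minimum below is over a finite set, which is nonempty iff \<open>t\<close> is at most the number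
  of edges.\<close>

definition opt_pvc :: "nat \<Rightarrow> 'v ugraph \<Rightarrow> nat" where
  "opt_pvc t G = Min (card ` {S. partial_vertex_cover t G S})"

section \<open>Linear systems and their homogenization\<close>

text \<open>A pair \<open>(a, b)\<close> stands for the constraint \<open>a\<^sup>T x \<ge> b\<close>. Homogenization and the hierarchies
  act on the system of constraints over the variable set \<open>Q\<close> (written \<open>[m]\<close> in the literature).\<close>

type_synonym 'q linear_system = "(('q \<Rightarrow> real) \<times> real) set"

definition subsets_upto :: "'q set \<Rightarrow> nat \<Rightarrow> 'q set set" where
  "subsets_upto Q r = {A. A \<subseteq> Q \<and> finite A \<and> card A \<le> r}"

text \<open>A vector indexed by \<open>subsets_upto Q k\<close> is represented by a total function on sets. Its values
  outside the index set are unconstrained and have no influence on any of the notions below.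
  The coordinate of a homogenized vector belonging to a variable \<open>q\<close> is the one at \<open>{q}\<close>, and
  the homogenizing coordinate is the one at \<open>{}\<close>.\<close>

definition homogenized_cone :: "'q set \<Rightarrow> 'q linear_system \<Rightarrow> ('q set \<Rightarrow> real) set" where
  "homogenized_cone Q C =
     {x. x {} \<ge> 0 \<and> (\<forall>(a, b) \<in> C. (\<Sum>q\<in>Q. a q * x {q}) \<ge> b * x {})}"

text \<open>The variables of the relaxation are the vertices (\<open>Inl\<close>) and the edges (\<open>Inr\<close>). The
  constraints are, in this order: \<open>x\<^sub>i + x\<^sub>j \<ge> x\<^sub>e\<close> for every edge \<open>e = {i, j}\<close>,
  the covering demand, and the lower and upper bounds of the unit cube.\<close>

definition pvc_vars :: "'v ugraph \<Rightarrow> ('v + 'v set) set" where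
  "pvc_vars G = Inl ` verts G \<union> Inr ` edges G"

definition pvc_system :: "nat \<Rightarrow> 'v ugraph \<Rightarrow> ('v + 'v set) linear_system" where
  "pvc_system t G =
     {(\<lambda>q. indicator (Inl ` e) q - indicator {Inr e} q, 0) | e. e \<in> edges G}
   \<union> {(indicator (Inr ` edges G), real t)}
   \<union> {(indicator {p}, 0) | p. p \<in> pvc_vars G}
   \<union> {(\<lambda>q. - indicator {p} q, - 1) | p. p \<in> pvc_vars G}"

lemma mem_homogenized_cone_pvc_iff:
  assumes "simple_graph G"
  shows "x \<in> homogenized_cone (pvc_vars G) (pvc_system t G) \<longleftrightarrow>
     x {} \<ge> 0 \<and>
     (\<forall>e\<in>edges G. (\<Sum>i\<in>e. x {Inl i}) \<ge> x {Inr e}) \<and>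
     (\<Sum>e\<in>edges G. x {Inr e}) \<ge> real t * x {} \<and>
     (\<forall>q\<in>pvc_vars G. 0 \<le> x {q} \<and> x {q} \<le> x {})"
proof -
  have E: "edges G \<subseteq> Pow (verts G)" and fV: "finite (verts G)"
    using assms by (auto simp: simple_graph_def)
  have fE: "finite (edges G)"
    using E fV by (meson finite_Pow_iff finite_subset)
  have fQ: "finite (pvc_vars G)"
    using fV fE by (simp add: pvc_vars_def)
  have ind: "(\<Sum>q\<in>pvc_vars G. indicator A q * x {q}) = (\<Sum>q\<in>A. x {q})"
    if "A \<subseteq> pvc_vars G" for A
  proof -
    have "(\<Sum>q\<in>pvc_vars G. indicator A q * x {q}) = (\<Sum>q\<in>pvc_vars G \<inter> A. x {q})"
      unfolding sum.inter_restrict[OF fQ] by (rule sum.cong) (auto simp: indicator_def)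
    then show ?thesis using that by (simp add: Int_absorb1)
  qed
  have pt: "(\<Sum>q\<in>pvc_vars G. indicator {p} q * x {q}) = x {p}" if "p \<in> pvc_vars G" for p
    using ind[of "{p}"] that by simp
  have edge: "(\<Sum>q\<in>pvc_vars G. (indicator (Inl ` e) q - indicator {Inr e} q) * x {q})
      = (\<Sum>i\<in>e. x {Inl i}) - x {Inr e}" if "e \<in> edges G" for e
  proof -
    have sub: "Inl ` e \<subseteq> pvc_vars G" and mem: "Inr e \<in> pvc_vars G"
      using that E by (auto simp: pvc_vars_def)
    show ?thesis
      using ind[OF sub] pt[OF mem] by (simp add: left_diff_distrib sum_subtractf sum.reindex)
  qed
  have dem: "(\<Sum>q\<in>pvc_vars G. indicator (Inr ` edges G) q * x {q}) = (\<Sum>e\<in>edges G. x {Inr e})"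
  proof -
    have "Inr ` edges G \<subseteq> pvc_vars G" by (auto simp: pvc_vars_def)
    from ind[OF this] show ?thesis by (simp add: sum.reindex)
  qed
  have coll: "(\<forall>z\<in>{f p | p. p \<in> A}. P z) \<longleftrightarrow> (\<forall>p\<in>A. P (f p))"
    for f :: "'b \<Rightarrow> 'c" and A P
    by auto
  show ?thesis
    unfolding homogenized_cone_def pvc_system_def mem_Collect_eq ball_Un coll
    by (auto simp: edge dem pt sum_negf)
qed

section \<open>Moment matrices\<close>

definition moment_matrix :: "('q set \<Rightarrow> real) \<Rightarrow> 'q set \<Rightarrow> 'q set \<Rightarrow> real" where
  "moment_matrix y A B = y (A \<union> B)"

definition unit_vec :: "'i \<Rightarrow> 'i \<Rightarrow> real" where
  "unit_vec I = indicator {I}"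

text \<open>Product of a matrix whose columns are indexed by \<open>J\<close> with a vector indexed by \<open>J\<close>.\<close>

definition mat_vec :: "'j set \<Rightarrow> ('i \<Rightarrow> 'j \<Rightarrow> real) \<Rightarrow> ('j \<Rightarrow> real) \<Rightarrow> 'i \<Rightarrow> real" where
  "mat_vec J M v = (\<lambda>A. \<Sum>B\<in>J. M A B * v B)"

definition psd_on :: "'i set \<Rightarrow> ('i \<Rightarrow> 'i \<Rightarrow> real) \<Rightarrow> bool" where
  "psd_on I M \<longleftrightarrow>
     (\<forall>A\<in>I. \<forall>B\<in>I. M A B = M B A) \<and>
     (\<forall>v. (\<Sum>A\<in>I. \<Sum>B\<in>I. v A * M A B * v B) \<ge> 0)"

section \<open>The Lovasz-Schrijver-SDP and Sherali-Adams-SDP hierarchies\<close>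

primrec LS_plus_cone :: "'q set \<Rightarrow> 'q linear_system \<Rightarrow> nat \<Rightarrow> ('q set \<Rightarrow> real) set" where
  "LS_plus_cone Q C 0 = homogenized_cone Q C"
| "LS_plus_cone Q C (Suc r) =
     {x. \<exists>y. let P1 = subsets_upto Q 1; Y = mat_vec P1 (moment_matrix y) in
        psd_on P1 (moment_matrix y) \<and>
        (\<forall>A\<in>P1. Y (unit_vec {}) A = x A) \<and>
        (\<forall>i\<in>Q. Y (unit_vec {i}) \<in> LS_plus_cone Q C r \<and>
               Y (\<lambda>B. unit_vec {} B - unit_vec {i} B) \<in> LS_plus_cone Q C r)}"

definition LS_plus :: "'q set \<Rightarrow> 'q linear_system \<Rightarrow> nat \<Rightarrow> ('q set \<Rightarrow> real) set" where
  "LS_plus Q C r = LS_plus_cone Q C r \<inter> {x. x {} = 1}"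

text \<open>\<open>SA_moments Q C r x y\<close>: the vector \<open>y\<close> witnesses that \<open>x\<close> belongs to the level-\<open>r\<close>
  Sherali-Adams cone.\<close>

definition SA_moments ::
    "'q set \<Rightarrow> 'q linear_system \<Rightarrow> nat \<Rightarrow> ('q set \<Rightarrow> real) \<Rightarrow> ('q set \<Rightarrow> real) \<Rightarrow> bool" where
  "SA_moments Q C r x y \<longleftrightarrow>
     (let Y = mat_vec (subsets_upto Q r) (moment_matrix y) in
        (\<forall>A\<in>subsets_upto Q 1. Y (unit_vec {}) A = x A) \<and>
        (\<forall>S N. S \<union> N \<in> subsets_upto Q r \<longrightarrow>
           Y (\<lambda>B. \<Sum>T\<in>Pow N. (- 1) ^ card T * unit_vec (S \<union> T) B) \<in> homogenized_cone Q C))"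

definition SA_plus :: "'q set \<Rightarrow> 'q linear_system \<Rightarrow> nat \<Rightarrow> ('q set \<Rightarrow> real) set" where
  "SA_plus Q C r =
     {x. x {} = 1 \<and> (\<exists>y. SA_moments Q C r x y \<and> psd_on (subsets_upto Q 1) (moment_matrix y))}"

section \<open>Integrality gap\<close>

text \<open>\<open>R\<close> is the feasible set of a tightening of the relaxation. Its optimal value is expressed as an
  infimum of reals; for a nonempty tightening at a demand \<open>t \<ge> 1\<close> it is positive, since
  \<open>x\<^sub>i + x\<^sub>j \<ge> x\<^sub>e\<close> and the demand constraint bound the objective away from 0.\<close>

definition pvc_relaxation_value :: "'v ugraph \<Rightarrow> (('v + 'v set) set \<Rightarrow> real) set \<Rightarrow> real" where
  "pvc_relaxation_value G R = (INF x\<in>R. \<Sum>i\<in>verts G. x {Inl i})"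

definition pvc_integrality_gap ::
    "nat \<Rightarrow> 'v ugraph \<Rightarrow> (('v + 'v set) set \<Rightarrow> real) set \<Rightarrow> real" where
  "pvc_integrality_gap t G R = real (opt_pvc t G) / pvc_relaxation_value G R"

end

theory Submission
  imports Defs
begin

text \<open>The tightenings are fooled by a probability measure on 0/1 points that is not supported on
  feasible points. With probability \<open>w\<close> for each vertex \<open>i\<close>, take the integral solution consisting of
  \<open>i\<close> and all its incident edges; with the remaining probability take the zero vector, which violates
  only the covering demand. Moments of a measure satisfy the semidefiniteness constraints, and they
  survive \<open>r\<close> rounds as soon as the demand holds on average after fixing the values of any \<open>r\<close>
  variables. Fixing one variable to 1 excludes the zero vector; fixing \<open>r\<close> variables to 0 excludes at
  most \<open>2 r\<close> of the vertices, and the remaining ones still cover enough edges on average when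
  \<open>w = t / ((n - 2 r) choose 2)\<close>.\<close>

section \<open>Moments of measures on 0/1 points\<close>

text \<open>A 0/1 point is identified with the set of variables that it sets to 1.\<close>

definition moments :: "'q set set \<Rightarrow> ('q set \<Rightarrow> real) \<Rightarrow> 'q set \<Rightarrow> real" where
  "moments F \<mu> A = (\<Sum>T\<in>F. \<mu> T * of_bool (A \<subseteq> T))"

text \<open>Conditioning without renormalizing: the cones are closed under nonnegative scaling, and
  events of mass 0 cause no division.\<close>

definition fix_vars :: "'q set \<Rightarrow> 'q set \<Rightarrow> ('q set \<Rightarrow> real) \<Rightarrow> 'q set \<Rightarrow> real" where
  "fix_vars S N \<mu> T = \<mu> T * of_bool (S \<subseteq> T \<and> N \<inter> T = {})"

lemma fix_vars_empty [simp]: "fix_vars {} {} \<mu> = \<mu>"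
  by (auto simp: fix_vars_def)

lemma fix_vars_fix_vars: "fix_vars S N (fix_vars S' N' \<mu>) = fix_vars (S \<union> S') (N \<union> N') \<mu>"
  by (auto simp: fix_vars_def fun_eq_iff)

lemma fix_vars_nonneg: "\<mu> T \<ge> 0 \<Longrightarrow> fix_vars S N \<mu> T \<ge> 0"
  by (simp add: fix_vars_def)

section \<open>Columns of the moment matrix\<close>

lemma finite_subsets_upto: "finite Q \<Longrightarrow> finite (subsets_upto Q r)"
  by (rule finite_subset[of _ "Pow Q"]) (auto simp: subsets_upto_def)

lemma mat_vec_unit_vec:
  assumes "finite J" "I \<in> J"
  shows "mat_vec J M (unit_vec I) A = M A I"
proof -
  have "mat_vec J M (unit_vec I) A = (\<Sum>B\<in>J. if B = I then M A B else 0)"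
    unfolding mat_vec_def unit_vec_def by (rule sum.cong) (auto simp: indicator_def)
  then show ?thesis using assms by simp
qed

lemma mat_vec_diff: "mat_vec J M (\<lambda>B. u B - v B) A = mat_vec J M u A - mat_vec J M v A"
  by (simp add: mat_vec_def right_diff_distrib sum_subtractf)

lemma mat_vec_sum:
  "mat_vec J M (\<lambda>B. \<Sum>k\<in>K. c k * v k B) A = (\<Sum>k\<in>K. c k * mat_vec J M (v k) A)"
  unfolding mat_vec_def sum_distrib_left by (subst sum.swap) (simp add: mult_ac)

text \<open>Expand the product over \<open>a\<close> in \<open>N\<close> of
  \<open>1 - of_bool (a \<in> W)\<close>: each new element multiplies the sum by one such
  factor.\<close>

lemma sum_alternating_subset:
  assumes "finite N"
  shows "(\<Sum>T\<in>Pow N. (- 1) ^ card T * of_bool (T \<subseteq> W)) = (of_bool (N \<inter> W = {}) :: real)"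
  using assms
proof (induction N)
  case empty
  then show ?case by simp
next
  case (insert a N)
  let ?f = "\<lambda>T. (- 1) ^ card T * of_bool (T \<subseteq> W) :: real"
  have inj: "inj_on (insert a) (Pow N)"
    using insert.hyps by (auto simp: inj_on_def)
  have "?f (Set.insert a T) = - of_bool (a \<in> W) * ?f T" if "T \<in> Pow N" for T
  proof -
    have "finite T" "a \<notin> T" using that insert.hyps finite_subset by auto
    then show ?thesis by simp
  qed
  then have "(\<Sum>T\<in>Set.insert a ` Pow N. ?f T) = - of_bool (a \<in> W) * (\<Sum>T\<in>Pow N. ?f T)"
    unfolding sum.reindex[OF inj] sum_distrib_left by simp
  moreover have "(\<Sum>T\<in>Pow (Set.insert a N). ?f T) =
      (\<Sum>T\<in>Pow N. ?f T) + (\<Sum>T\<in>Set.insert a ` Pow N. ?f T)"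
    unfolding Pow_insert by (rule sum.union_disjoint) (use insert.hyps in auto)
  ultimately show ?case using insert.IH by auto
qed

lemma moments_Un: "moments F \<mu> (A \<union> S) = moments F (fix_vars S {} \<mu>) A"
  unfolding moments_def fix_vars_def by (rule sum.cong) auto

text \<open>Links the Sherali-Adams combination of columns to conditioning. After exchanging the
  sums, the alternating sum at each point \<open>W\<close> is the indicator that \<open>W\<close>
  avoids \<open>N\<close>.\<close>

lemma moments_fix_vars:
  assumes "finite N"
  shows "(\<Sum>T\<in>Pow N. (- 1) ^ card T * moments F \<mu> (A \<union> (S \<union> T))) = moments F (fix_vars S N \<mu>) A"
proof -
  have "(\<Sum>T\<in>Pow N. (- 1) ^ card T * moments F \<mu> (A \<union> (S \<union> T))) =
      (\<Sum>W\<in>F. \<Sum>T\<in>Pow N. (- 1) ^ card T * (\<mu> W * of_bool (A \<union> (S \<union> T) \<subseteq> W)))"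
    unfolding moments_def sum_distrib_left by (rule sum.swap)
  also have "\<dots> = (\<Sum>W\<in>F. \<mu> W * of_bool (A \<union> S \<subseteq> W) *
      (\<Sum>T\<in>Pow N. (- 1) ^ card T * of_bool (T \<subseteq> W)))"
    unfolding sum_distrib_left by (intro sum.cong refl) auto
  also have "\<dots> = moments F (fix_vars S N \<mu>) A"
    unfolding sum_alternating_subset[OF assms] moments_def fix_vars_def
    by (intro sum.cong refl) auto
  finally show ?thesis .
qed

lemma moments_diff: "moments F \<mu> A - moments F \<mu> (A \<union> {q}) = moments F (fix_vars {} {q} \<mu>) A"
  unfolding moments_def fix_vars_def sum_subtractf[symmetric] by (intro sum.cong refl) auto

text \<open>The matrix is the sum of the rank-one matrices of the points, weighted by \<mu>, so its
  quadratic form is a weighted sum of squares.\<close>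

lemma psd_on_moments:
  assumes "\<And>T. T \<in> F \<Longrightarrow> \<mu> T \<ge> 0"
  shows "psd_on I (moment_matrix (moments F \<mu>))"
  unfolding psd_on_def
proof (intro conjI allI ballI)
  show "moment_matrix (moments F \<mu>) A B = moment_matrix (moments F \<mu>) B A" for A B
    by (simp add: moment_matrix_def Un_commute)
next
  fix v :: "'a set \<Rightarrow> real"
  have "(\<Sum>A\<in>I. \<Sum>B\<in>I. v A * moment_matrix (moments F \<mu>) A B * v B) =
      (\<Sum>A\<in>I. \<Sum>B\<in>I. \<Sum>T\<in>F. \<mu> T * ((v A * of_bool (A \<subseteq> T)) * (v B * of_bool (B \<subseteq> T))))"
    unfolding moment_matrix_def moments_def sum_distrib_left sum_distrib_right
    by (intro sum.cong refl) auto
  also have "\<dots> = (\<Sum>A\<in>I. \<Sum>T\<in>F. \<Sum>B\<in>I. \<mu> T * ((v A * of_bool (A \<subseteq> T)) * (v B * of_bool (B \<subseteq> T))))"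
    by (intro sum.cong refl sum.swap)
  also have "\<dots> = (\<Sum>T\<in>F. \<Sum>A\<in>I. \<Sum>B\<in>I. \<mu> T * ((v A * of_bool (A \<subseteq> T)) * (v B * of_bool (B \<subseteq> T))))"
    by (rule sum.swap)
  also have "\<dots> = (\<Sum>T\<in>F. \<mu> T * (\<Sum>A\<in>I. v A * of_bool (A \<subseteq> T))\<^sup>2)"
    by (simp add: power2_eq_square sum_product) (simp add: sum_distrib_left)
  also have "\<dots> \<ge> 0"
    by (intro sum_nonneg mult_nonneg_nonneg assms) auto
  finally show "0 \<le> (\<Sum>A\<in>I. \<Sum>B\<in>I. v A * moment_matrix (moments F \<mu>) A B * v B)" .
qed

section \<open>Survival of moment vectors in both hierarchies\<close>

text \<open>The moments themselves serve as the witness \<open>y\<close> at every level. The column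
  for \<open>{i}\<close>, and the column for \<open>{}\<close> minus it, are again moment vectors,
  of the measure with \<open>i\<close> fixed to 1 or 0; hence the induction with \<mu>
  arbitrary.\<close>

lemma moments_in_LS_plus_cone:
  assumes "finite Q"
    and "\<And>T. T \<in> F \<Longrightarrow> \<mu> T \<ge> 0"
    and "\<And>S N. S \<union> N \<in> subsets_upto Q r \<Longrightarrow> moments F (fix_vars S N \<mu>) \<in> homogenized_cone Q C"
  shows "moments F \<mu> \<in> LS_plus_cone Q C r"
  using assms(2,3)
proof (induction r arbitrary: \<mu>)
  case 0
  from "0.prems"(2)[of "{}" "{}"] show ?case by (simp add: subsets_upto_def)
next
  case (Suc r)
  let ?P = "subsets_upto Q 1" and ?M = "moment_matrix (moments F \<mu>)"
  have fin: "finite ?P" by (rule finite_subsets_upto[OF assms(1)])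
  have sets: "{} \<in> ?P" "\<And>i. i \<in> Q \<Longrightarrow> {i} \<in> ?P"
    by (auto simp: subsets_upto_def)
  have col0: "mat_vec ?P ?M (unit_vec {}) = moments F \<mu>"
    by (rule ext) (simp only: mat_vec_unit_vec[OF fin sets(1)] moment_matrix_def Un_empty_right)
  have col: "mat_vec ?P ?M (unit_vec {i}) = moments F (fix_vars {i} {} \<mu>)" if "i \<in> Q" for i
    by (rule ext) (simp only: mat_vec_unit_vec[OF fin sets(2)[OF that]] moment_matrix_def moments_Un)
  have col': "mat_vec ?P ?M (\<lambda>B. unit_vec {} B - unit_vec {i} B) = moments F (fix_vars {} {i} \<mu>)"
    if "i \<in> Q" for i
    by (rule ext) (simp only: mat_vec_diff mat_vec_unit_vec[OF fin sets(1)]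
      mat_vec_unit_vec[OF fin sets(2)[OF that]] moment_matrix_def Un_empty_right moments_diff)
  have mem: "moments F (fix_vars S' N' \<mu>) \<in> LS_plus_cone Q C r"
    if "i \<in> Q" and SN': "S' \<union> N' = {i}" for i S' N'
  proof (rule Suc.IH)
    show "fix_vars S' N' \<mu> T \<ge> 0" if "T \<in> F" for T
      using Suc.prems(1)[OF that] by (rule fix_vars_nonneg)
  next
    fix S N assume SN: "S \<union> N \<in> subsets_upto Q r"
    \<comment> \<open>Fixing \<open>r\<close> variables on top of \<open>i\<close> fixes at most
      \<open>Suc r\<close>, which the hypothesis on \<mu> allows.\<close>
    have "(S \<union> S') \<union> (N \<union> N') = insert i (S \<union> N)"
      using SN' by auto
    also have "\<dots> \<in> subsets_upto Q (Suc r)"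
      using SN \<open>i \<in> Q\<close> by (auto simp: subsets_upto_def card_insert_if)
    finally show "moments F (fix_vars S N (fix_vars S' N' \<mu>)) \<in> homogenized_cone Q C"
      unfolding fix_vars_fix_vars by (rule Suc.prems(2))
  qed
  show ?case
    unfolding LS_plus_cone.simps mem_Collect_eq Let_def
    by (rule exI[of _ "moments F \<mu>"])
      (use psd_on_moments[of F \<mu> ?P] Suc.prems(1) mem in
        \<open>auto simp: col0 col col' simp del: One_nat_def\<close>)
qed

lemma SA_moments_moments:
  assumes "finite Q"
    and "\<And>S N. S \<union> N \<in> subsets_upto Q r \<Longrightarrow> moments F (fix_vars S N \<mu>) \<in> homogenized_cone Q C"
  shows "SA_moments Q C r (moments F \<mu>) (moments F \<mu>)"
proof -
  let ?P = "subsets_upto Q r" and ?M = "moment_matrix (moments F \<mu>)"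
  have fin: "finite ?P" by (rule finite_subsets_upto[OF assms(1)])
  have "mat_vec ?P ?M (unit_vec {}) A = moments F \<mu> A" for A
    by (subst mat_vec_unit_vec[OF fin]) (simp_all add: moment_matrix_def subsets_upto_def)
  moreover have "mat_vec ?P ?M (\<lambda>B. \<Sum>T\<in>Pow N. (- 1) ^ card T * unit_vec (S \<union> T) B)
      = moments F (fix_vars S N \<mu>)" if SN: "S \<union> N \<in> ?P" for S N
  proof
    fix A
    \<comment> \<open>Every index must be one of the available columns for its unit vector to select
      that column.\<close>
    have "S \<union> T \<in> ?P" if "T \<in> Pow N" for T
    proof -
      have "S \<union> T \<subseteq> S \<union> N" using that by auto
      with SN card_mono[OF _ this] show ?thesis
        by (auto simp: subsets_upto_def intro: finite_subset)
    qed
    then have "mat_vec ?P ?M (\<lambda>B. \<Sum>T\<in>Pow N. (- 1) ^ card T * unit_vec (S \<union> T) B) A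
        = (\<Sum>T\<in>Pow N. (- 1) ^ card T * moments F \<mu> (A \<union> (S \<union> T)))"
      unfolding mat_vec_sum
      by (intro sum.cong refl) (simp add: mat_vec_unit_vec[OF fin] moment_matrix_def)
    also have "\<dots> = moments F (fix_vars S N \<mu>) A"
      using SN by (intro moments_fix_vars) (auto simp: subsets_upto_def)
    finally show "mat_vec ?P ?M (\<lambda>B. \<Sum>T\<in>Pow N. (- 1) ^ card T * unit_vec (S \<union> T) B) A
        = moments F (fix_vars S N \<mu>) A" .
  qed
  ultimately show ?thesis
    unfolding SA_moments_def Let_def using assms(2) by simp
qed

section \<open>The tightenings lie inside the relaxation\<close>

lemma homogenized_cone_add:
  assumes "x \<in> homogenized_cone Q C" "y \<in> homogenized_cone Q C"
  shows "(\<lambda>A. x A + y A) \<in> homogenized_cone Q C"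
proof -
  have "b * (x {} + y {}) \<le> (\<Sum>q\<in>Q. a q * (x {q} + y {q}))" if "(a, b) \<in> C" for a b
  proof -
    have "b * x {} \<le> (\<Sum>q\<in>Q. a q * x {q})" "b * y {} \<le> (\<Sum>q\<in>Q. a q * y {q})"
      using assms that by (auto simp: homogenized_cone_def)
    then show ?thesis by (simp add: distrib_left sum.distrib)
  qed
  then show ?thesis
    using assms by (auto simp: homogenized_cone_def)
qed

text \<open>Vectors are total functions, while the hierarchies tie \<open>x\<close> to the moment
  matrix on \<open>subsets_upto Q 1\<close> only; the cone reads no other coordinates.\<close>

lemma homogenized_cone_cong:
  assumes "x \<in> homogenized_cone Q C" "\<And>A. A \<in> subsets_upto Q 1 \<Longrightarrow> x A = y A"
  shows "y \<in> homogenized_cone Q C"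
proof -
  have "y {} = x {}" "\<And>q. q \<in> Q \<Longrightarrow> y {q} = x {q}"
    using assms(2) by (auto simp: subsets_upto_def)
  moreover from this(2) have "(\<Sum>q\<in>Q. a q * y {q}) = (\<Sum>q\<in>Q. a q * x {q})" for a :: "'a \<Rightarrow> real"
    by simp
  ultimately show ?thesis
    using assms(1) by (simp add: homogenized_cone_def)
qed

text \<open>The column for \<open>{i}\<close> and its complement add up to the column for
  \<open>{}\<close>, which agrees with \<open>x\<close>, and the cone is closed under addition.
  Nonemptiness of \<open>Q\<close> supplies the \<open>i\<close>.\<close>

lemma LS_plus_cone_subset:
  assumes "Q \<noteq> {}"
  shows "LS_plus_cone Q C r \<subseteq> homogenized_cone Q C"
proof (induction r)
  case 0
  then show ?case by simp
next
  case (Suc r)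
  show ?case
  proof
    fix x assume "x \<in> LS_plus_cone Q C (Suc r)"
    then obtain y where y:
      "\<And>A. A \<in> subsets_upto Q 1 \<Longrightarrow>
        mat_vec (subsets_upto Q 1) (moment_matrix y) (unit_vec {}) A = x A"
      "\<And>i. i \<in> Q \<Longrightarrow>
        mat_vec (subsets_upto Q 1) (moment_matrix y) (unit_vec {i}) \<in> LS_plus_cone Q C r"
      "\<And>i. i \<in> Q \<Longrightarrow>
        mat_vec (subsets_upto Q 1) (moment_matrix y) (\<lambda>B. unit_vec {} B - unit_vec {i} B)
          \<in> LS_plus_cone Q C r"
      by (auto simp: Let_def)
    from assms obtain i where i: "i \<in> Q" by auto
    show "x \<in> homogenized_cone Q C"
    proof (rule homogenized_cone_cong)
      show "(\<lambda>A. mat_vec (subsets_upto Q 1) (moment_matrix y) (unit_vec {i}) A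
          + mat_vec (subsets_upto Q 1) (moment_matrix y) (\<lambda>B. unit_vec {} B - unit_vec {i} B) A)
          \<in> homogenized_cone Q C"
        using y(2,3)[OF i] Suc.IH by (intro homogenized_cone_add) auto
    qed (simp add: mat_vec_diff y(1) del: One_nat_def)
  qed
qed

text \<open>Taking \<open>S = N = {}\<close> leaves just the column for \<open>{}\<close>.\<close>

lemma SA_plus_subset: "SA_plus Q C r \<subseteq> homogenized_cone Q C"
proof
  fix x assume "x \<in> SA_plus Q C r"
  then obtain y where "SA_moments Q C r x y"
    by (auto simp: SA_plus_def)
  then have x: "\<And>A. A \<in> subsets_upto Q 1 \<Longrightarrow>
      mat_vec (subsets_upto Q r) (moment_matrix y) (unit_vec {}) A = x A"
    and cone: "\<And>S N. S \<union> N \<in> subsets_upto Q r \<Longrightarrow>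
      mat_vec (subsets_upto Q r) (moment_matrix y)
        (\<lambda>B. \<Sum>T\<in>Pow N. (- 1) ^ card T * unit_vec (S \<union> T) B) \<in> homogenized_cone Q C"
    by (auto simp: SA_moments_def Let_def)
  show "x \<in> homogenized_cone Q C"
    by (rule homogenized_cone_cong[OF _ x])
      (use cone[of "{}" "{}"] in \<open>auto simp: subsets_upto_def\<close>)
qed

section \<open>Bounds on the integrality gap\<close>

lemma simple_graph_finite_edges: "simple_graph G \<Longrightarrow> finite (edges G)"
  by (rule finite_subset[of _ "Pow (verts G)"]) (auto simp: simple_graph_def)

lemma finite_pvc_vars: "simple_graph G \<Longrightarrow> finite (pvc_vars G)"
  by (simp add: pvc_vars_def simple_graph_finite_edges) (simp add: simple_graph_def)

text \<open>Each edge variable is at most the sum at its two endpoints, hence at most the whole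
  objective; sum over the edges. This keeps the relaxation value away from 0.\<close>

lemma relaxation_objective_bound:
  assumes "simple_graph G" "x \<in> homogenized_cone (pvc_vars G) (pvc_system t G)" "x {} = 1"
  shows "real t \<le> real (card (edges G)) * (\<Sum>i\<in>verts G. x {Inl i})"
proof -
  have x: "\<And>e. e \<in> edges G \<Longrightarrow> x {Inr e} \<le> (\<Sum>i\<in>e. x {Inl i})"
    "real t \<le> (\<Sum>e\<in>edges G. x {Inr e})"
    "\<And>i. i \<in> verts G \<Longrightarrow> 0 \<le> x {Inl i}"
    using assms(2,3) unfolding mem_homogenized_cone_pvc_iff[OF assms(1)]
    by (auto simp: pvc_vars_def)
  have "(\<Sum>e\<in>edges G. x {Inr e}) \<le> (\<Sum>e\<in>edges G. \<Sum>i\<in>verts G. x {Inl i})"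
  proof (rule sum_mono)
    fix e assume e: "e \<in> edges G"
    have "(\<Sum>i\<in>e. x {Inl i}) \<le> (\<Sum>i\<in>verts G. x {Inl i})"
      using assms(1) e x(3) by (intro sum_mono2) (auto simp: simple_graph_def)
    with x(1)[OF e] show "x {Inr e} \<le> (\<Sum>i\<in>verts G. x {Inl i})" by simp
  qed
  with x(2) show ?thesis by simp
qed

text \<open>The empty set covers nothing, and this trivial bound on the integral optimum is enough
  for the gap. \<open>S\<^sub>0\<close> witnesses that the minimum is over a nonempty set.\<close>

lemma opt_pvc_ge_1:
  assumes "simple_graph G" "t \<ge> 1" "partial_vertex_cover t G S\<^sub>0"
  shows "opt_pvc t G \<ge> 1"
proof -
  have fin: "finite (verts G)" using assms(1) by (simp add: simple_graph_def)
  then have "finite {S. partial_vertex_cover t G S}"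
    by (rule finite_subset[rotated, OF finite_Pow_iff[THEN iffD2]])
      (auto simp: partial_vertex_cover_def)
  moreover have "card S \<ge> 1" if "partial_vertex_cover t G S" for S
  proof -
    have "S \<noteq> {}" "finite S"
      using that assms(2) finite_subset[OF _ fin] by (auto simp: partial_vertex_cover_def)
    then show ?thesis by (simp add: Suc_le_eq card_gt_0_iff)
  qed
  ultimately show ?thesis
    unfolding opt_pvc_def using assms(3) by (subst Min_ge_iff) auto
qed

text \<open>Positivity of the relaxation value matters because the gap is 0 if that value is 0.\<close>

lemma integrality_gap_ge:
  assumes "simple_graph G" "t \<ge> 1" "partial_vertex_cover t G S\<^sub>0"
    and sub: "R \<subseteq> homogenized_cone (pvc_vars G) (pvc_system t G) \<inter> {x. x {} = 1}"
    and "x \<in> R" "(\<Sum>i\<in>verts G. x {Inl i}) \<le> b"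
  shows "pvc_integrality_gap t G R \<ge> 1 / b"
proof -
  let ?obj = "\<lambda>x. \<Sum>i\<in>verts G. x {Inl i} :: real"
  define m where "m = real (card (edges G))"
  have bound: "real t \<le> m * ?obj z" if "z \<in> R" for z
    unfolding m_def using that sub by (intro relaxation_objective_bound[OF assms(1)]) auto
  \<comment> \<open>Without edges, \<open>bound\<close> would read \<open>t \<le> 0\<close>.\<close>
  have m: "m > 0"
    using bound[OF \<open>x \<in> R\<close>] \<open>t \<ge> 1\<close> unfolding m_def by (cases "card (edges G)") auto
  have ge: "real t / m \<le> ?obj z" if "z \<in> R" for z
    using bound[OF that] m by (simp add: field_simps)
  have "real t / m \<le> pvc_relaxation_value G R"
    unfolding pvc_relaxation_value_def by (rule cINF_greatest) (use \<open>x \<in> R\<close> ge in auto)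
  moreover have "real t / m > 0" using m \<open>t \<ge> 1\<close> by simp
  ultimately have pos: "pvc_relaxation_value G R > 0" by linarith
  have "bdd_below (?obj ` R)"
    by (rule bdd_belowI[of _ "real t / m"]) (use ge in auto)
  then have "pvc_relaxation_value G R \<le> ?obj x"
    unfolding pvc_relaxation_value_def using \<open>x \<in> R\<close> by (intro cINF_lower) auto
  then have "pvc_relaxation_value G R \<le> b" using assms(6) by linarith
  then have "1 / b \<le> 1 / pvc_relaxation_value G R"
    using pos by (simp add: frac_le)
  also have "\<dots> \<le> pvc_integrality_gap t G R"
    unfolding pvc_integrality_gap_def using pos opt_pvc_ge_1[OF assms(1-3)]
    by (intro divide_right_mono) auto
  finally show ?thesis .
qed

section \<open>The measure on stars of the complete graph\<close>

definition star :: "'v ugraph \<Rightarrow> 'v \<Rightarrow> ('v + 'v set) set" where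
  "star G i = insert (Inl i) (Inr ` {e \<in> edges G. i \<in> e})"

text \<open>Meant on \<open>stars G\<close> only: the zero vector receives the mass that the stars
  leave from a total of 1.\<close>

definition star_measure :: "'v ugraph \<Rightarrow> real \<Rightarrow> ('v + 'v set) set \<Rightarrow> real" where
  "star_measure G w T = (if T = {} then 1 - real (card (verts G)) * w else w)"

definition stars :: "'v ugraph \<Rightarrow> ('v + 'v set) set set" where
  "stars G = insert {} (star G ` verts G)"

lemma Inl_in_star [simp]: "Inl j \<in> star G i \<longleftrightarrow> j = i"
  and Inr_in_star [simp]: "Inr e \<in> star G i \<longleftrightarrow> e \<in> edges G \<and> i \<in> e"
  and star_nonempty [simp]: "star G i \<noteq> {}"
  by (auto simp: star_def)

lemma sum_stars:
  assumes "finite (verts G)"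
  shows "(\<Sum>T\<in>stars G. f T) = f {} + (\<Sum>i\<in>verts G. f (star G i))"
proof -
  have "inj_on (star G) (verts G)"
    by (rule inj_onI) (metis Inl_in_star)
  moreover have "{} \<notin> star G ` verts G"
    using star_nonempty by (metis imageE)
  ultimately show ?thesis
    unfolding stars_def using assms by (simp add: sum.reindex)
qed

lemma moments_stars:
  assumes "finite (verts G)"
  shows "moments (stars G) \<nu> A =
    \<nu> {} * of_bool (A = {}) + (\<Sum>i\<in>verts G. \<nu> (star G i) * of_bool (A \<subseteq> star G i))"
  unfolding moments_def sum_stars[OF assms] by simp

lemma card_incident_edges:
  assumes "simple_graph G" "complete_graph G" "i \<in> verts G"
  shows "card {e \<in> edges G. i \<in> e} = card (verts G) - 1"
proof -
  have "{e \<in> edges G. i \<in> e} = (\<lambda>j. {i, j}) ` (verts G - {i})"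
    using assms(2,3) unfolding complete_graph_def
    by (auto simp: card_2_iff image_iff doubleton_eq_iff)
  moreover have "inj_on (\<lambda>j. {i, j}) (verts G - {i})"
    by (auto simp: inj_on_def doubleton_eq_iff)
  ultimately show ?thesis
    using assms(1,3) by (simp add: card_image simple_graph_def)
qed

text \<open>Arbitrary nonnegative weights make this applicable to conditioned measures. All
  constraints but the demand hold at every point; a star covers \<open>card (verts G) - 1\<close>
  edges, so the demand becomes a condition on the average.\<close>

lemma moments_stars_in_cone:
  assumes G: "simple_graph G" "complete_graph G"
    and nonneg: "\<nu> {} \<ge> 0" "\<And>i. i \<in> verts G \<Longrightarrow> \<nu> (star G i) \<ge> 0"
    and demand: "real t * (\<nu> {} + (\<Sum>i\<in>verts G. \<nu> (star G i)))
      \<le> real (card (verts G) - 1) * (\<Sum>i\<in>verts G. \<nu> (star G i))"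
  shows "moments (stars G) \<nu> \<in> homogenized_cone (pvc_vars G) (pvc_system t G)"
proof -
  let ?V = "verts G" and ?E = "edges G" and ?y = "moments (stars G) \<nu>"
  have fV: "finite ?V" using G(1) by (simp add: simple_graph_def)
  note mom = moments_stars[OF fV]
  have edge: "?y {Inr e} \<le> (\<Sum>j\<in>e. ?y {Inl j})" if e: "e \<in> ?E" for e
  proof -
    have fe: "finite e"
      using e G(1) fV by (auto simp: simple_graph_def intro: finite_subset)
    \<comment> \<open>At the star of \<open>i\<close> both sides of the edge constraint equal
      \<open>of_bool (i \<in> e)\<close>, so the constraint is tight.\<close>
    have "(\<Sum>j\<in>e. ?y {Inl j}) = (\<Sum>i\<in>?V. \<Sum>j\<in>e. \<nu> (star G i) * of_bool (j = i))"
      unfolding mom by (simp add: sum.swap[of _ ?V])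
    also have "\<dots> = (\<Sum>i\<in>?V. \<nu> (star G i) * of_bool (i \<in> e))"
      using fe by (intro sum.cong refl) (simp add: of_bool_def if_distrib sum.delta cong: if_cong)
    finally show ?thesis
      using e by (simp add: mom)
  qed
  have "(\<Sum>e\<in>?E. ?y {Inr e}) = (\<Sum>i\<in>?V. \<Sum>e\<in>?E. \<nu> (star G i) * of_bool (i \<in> e))"
    unfolding mom by (subst sum.swap) simp
  also have "\<dots> = (\<Sum>i\<in>?V. \<nu> (star G i) * real (card (?V) - 1))"
  proof (rule sum.cong[OF refl])
    fix i assume i: "i \<in> ?V"
    have "(\<Sum>e\<in>?E. of_bool (i \<in> e) :: real) = real (card {e \<in> ?E. i \<in> e})"
      using simple_graph_finite_edges[OF G(1)] by (simp add: Int_def)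
    then show "(\<Sum>e\<in>?E. \<nu> (star G i) * of_bool (i \<in> e)) = \<nu> (star G i) * real (card ?V - 1)"
      by (simp add: sum_distrib_left[symmetric] card_incident_edges[OF G i])
  qed
  also have "\<dots> = real (card ?V - 1) * (\<Sum>i\<in>?V. \<nu> (star G i))"
    by (simp add: sum_distrib_left mult.commute)
  finally have "real t * ?y {} \<le> (\<Sum>e\<in>?E. ?y {Inr e})"
    using demand by (simp add: mom)
  moreover have "0 \<le> ?y {q} \<and> ?y {q} \<le> ?y {}" for q
    unfolding mom using nonneg
    by (auto intro!: sum_nonneg add_increasing sum_mono)
  moreover have "0 \<le> ?y {}"
    unfolding mom using nonneg by (auto intro!: sum_nonneg add_nonneg_nonneg)
  ultimately show ?thesis
    unfolding mem_homogenized_cone_pvc_iff[OF G(1)] using edge by blast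
qed

text \<open>A variable fixed to 0 excludes only the stars containing it: one for a vertex, two for
  an edge. \<open>touched\<close> collects their centres.\<close>

lemma card_star_disjoint:
  assumes "simple_graph G" "N \<in> subsets_upto (pvc_vars G) r"
  shows "card (verts G) - 2 * r \<le> card {i \<in> verts G. N \<inter> star G i = {}}"
proof -
  let ?V = "verts G"
  define touched where "touched q = (case q of Inl i \<Rightarrow> {i} | Inr e \<Rightarrow> e)" for q :: "'a + 'a set"
  have fV: "finite ?V" using assms(1) by (simp add: simple_graph_def)
  have N: "N \<subseteq> pvc_vars G" "finite N" "card N \<le> r"
    using assms(2) by (auto simp: subsets_upto_def)
  have c: "finite (touched q) \<and> card (touched q) \<le> 2" if "q \<in> N" for q
  proof (cases q)
    case (Inr e)
    then have "card e = 2"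
      using that N(1) assms(1) by (auto simp: pvc_vars_def simple_graph_def)
    with Inr show ?thesis by (simp add: touched_def card_ge_0_finite)
  qed (simp add: touched_def)
  have "card (\<Union>q\<in>N. touched q) \<le> (\<Sum>q\<in>N. card (touched q))"
    using N(2) by (rule card_UN_le)
  also have "\<dots> \<le> (\<Sum>q\<in>N. 2)"
    using c by (intro sum_mono) auto
  also have "\<dots> \<le> 2 * r" using N(3) by simp
  finally have "card ?V - 2 * r \<le> card ?V - card (\<Union>q\<in>N. touched q)" by simp
  also have "\<dots> \<le> card (?V - (\<Union>q\<in>N. touched q))"
    using N(2) c by (intro diff_card_le_card_Diff) auto
  also have "\<dots> \<le> card {i \<in> ?V. N \<inter> star G i = {}}"
    using fV by (intro card_mono) (auto simp: star_def touched_def split: sum.splits)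
  finally show ?thesis .
qed

text \<open>The zero vector falls short of the demand by \<open>t\<close>, and each star exceeds it
  by \<open>card (verts G) - 1 - t\<close>. A nonempty \<open>S\<close> removes the zero vector. If
  \<open>S\<close> is empty, at least \<open>card (verts G) - 2 * r\<close> stars of weight
  \<open>w\<close> remain to compensate for it, and \<open>demand\<close> is this worst
  case.\<close>

lemma star_moments_in_cone:
  assumes G: "simple_graph G" "complete_graph G"
    and t: "t \<le> card (verts G) - 1"
    and w: "w \<ge> 0" "real (card (verts G)) * w \<le> 1"
    and demand: "real t * (1 - real (card (verts G)) * w)
      \<le> real (card (verts G) - 1 - t) * (real (card (verts G) - 2 * r) * w)"
    and SN: "S \<union> N \<in> subsets_upto (pvc_vars G) r"
  shows "moments (stars G) (fix_vars S N (star_measure G w))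
    \<in> homogenized_cone (pvc_vars G) (pvc_system t G)"
proof (rule moments_stars_in_cone[OF G])
  let ?V = "verts G" and ?\<nu> = "fix_vars S N (star_measure G w)"
  let ?s = "\<Sum>i\<in>?V. ?\<nu> (star G i)"
  have fV: "finite ?V" using G(1) by (simp add: simple_graph_def)
  show "?\<nu> {} \<ge> 0" and nonneg: "?\<nu> (star G i) \<ge> 0" for i
    using w by (auto intro!: fix_vars_nonneg simp: star_measure_def)
  have s: "?s \<ge> 0" by (intro sum_nonneg nonneg)
  have main: "real t * ?\<nu> {} \<le> real (card ?V - 1 - t) * ?s"
  proof (cases "S = {}")
    case True
    have "real (card ?V - 2 * r) * w \<le> real (card {i \<in> ?V. N \<inter> star G i = {}}) * w"
      using card_star_disjoint[OF G(1), of N r] SN True w(1)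
      by (intro mult_right_mono) auto
    also have "\<dots> = ?s"
      using fV True by (simp add: fix_vars_def star_measure_def sum_distrib_left[symmetric] Int_def)
    finally have "real (card ?V - 1 - t) * (real (card ?V - 2 * r) * w) \<le> real (card ?V - 1 - t) * ?s"
      by (rule mult_left_mono) simp
    with demand True show ?thesis
      by (simp add: fix_vars_def star_measure_def)
  next
    case False
    then have "?\<nu> {} = 0" by (simp add: fix_vars_def)
    with s show ?thesis by simp
  qed
  show "real t * (?\<nu> {} + ?s) \<le> real (card ?V - 1) * ?s"
    using main unfolding of_nat_diff[OF t] by (simp only: algebra_simps)
qed

section \<open>Choice of the weight\<close>

lemma star_weight_exists:
  fixes n r t :: nat
  assumes "t \<ge> 1" "n \<ge> 2 * r + 2 * t + 2"
  obtains w where "w \<ge> 0" "real n * w \<le> 1"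
    "real n * w \<le> real t * real n / real ((n - 2 * r) choose 2)"
    "real t * (1 - real n * w) \<le> real (n - 1 - t) * (real (n - 2 * r) * w)"
proof -
  define k where "k = n - 2 * r"
  have k: "k \<ge> 4" "k \<le> n" "n \<ge> 2 * t + 2"
    using assms by (auto simp: k_def)
  define C where "C = real (k choose 2)"
  have C: "C = real k * (real k - 1) / 2"
    using k(1) by (simp add: C_def choose_two real_of_nat_div of_nat_diff)
  have C0: "C > 0" unfolding C using k(1) by simp
  have n0: "real n > 0" using k by simp
  \<comment> \<open>The weight \<open>t / C\<close> gives the objective \<open>t * n / C\<close>;
    the cap \<open>1 / n\<close> keeps the mass of the zero vector nonnegative.\<close>
  define w where "w = min (1 / real n) (real t / C)"
  have w0: "w \<ge> 0" using C0 by (simp add: w_def)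
  have w1: "real n * w \<le> 1" using n0 by (simp add: w_def min_def field_simps)
  have "w \<le> real t / C" by (simp add: w_def)
  then have "real n * w \<le> real n * (real t / C)"
    using n0 by (intro mult_left_mono) auto
  then have w2: "real n * w \<le> real t * real n / C"
    by (simp add: mult.commute)
  have w3: "real t * (1 - real n * w) \<le> real (n - 1 - t) * (real k * w)"
  \<comment> \<open>At the cap the zero vector has mass 0, so there is no deficit. Otherwise
    \<open>C * w = t\<close>, and \<open>C \<le> (n - 1 - t) * k\<close> suffices.\<close>
  proof (cases "w = 1 / real n")
    case True
    with n0 show ?thesis by simp
  next
    case False
    then have w: "w = real t / C" by (auto simp: w_def min_def split: if_splits)
    have "C \<le> real (n - 1 - t) * real k"
    proof -
      \<comment> \<open>Already \<open>(n - 1) / 2\<close> is at most \<open>n - 1 - t\<close>,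
        because \<open>n \<ge> 2 * t + 2\<close>.\<close>
      have "(real k - 1) / 2 \<le> real (n - 1 - t)"
        using k by (simp add: of_nat_diff)
      then have "real k * ((real k - 1) / 2) \<le> real k * real (n - 1 - t)"
        by (intro mult_left_mono) auto
      then show ?thesis by (simp add: C mult.commute)
    qed
    then have "C * w \<le> real (n - 1 - t) * real k * w"
      using w0 by (intro mult_right_mono) auto
    moreover have "C * w = real t" using C0 by (simp add: w)
    moreover have "real t * (1 - real n * w) \<le> real t"
      using n0 w0 by (simp add: mult_left_le)
    ultimately show ?thesis by (simp add: mult.assoc)
  qed
  show thesis
    using that[OF w0 w1] w2 w3 unfolding C_def k_def by blast
qed

section \<open>The gap for the complete graph\<close>

theorem theorem2:
  fixes n r t :: nat
  assumes "r \<ge> 1" and "t \<ge> 1" and "n \<ge> 2 * r + 2 * t + 2"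
  shows "\<exists>G :: nat ugraph.
    simple_graph G \<and> card (verts G) = n \<and> complete_graph G \<and>
    pvc_integrality_gap t G (LS_plus (pvc_vars G) (pvc_system t G) r)
      \<ge> real ((n - 2 * r) choose 2) / (real t * real n) \<and>
    pvc_integrality_gap t G (SA_plus (pvc_vars G) (pvc_system t G) r)
      \<ge> real ((n - 2 * r) choose 2) / (real t * real n)"
proof -
  define G :: "nat ugraph" where "G = \<lparr>verts = {..<n}, edges = {e. e \<subseteq> {..<n} \<and> card e = 2}\<rparr>"
  have G: "simple_graph G" "complete_graph G" and card: "card (verts G) = n"
    and fV: "finite (verts G)" and V0: "0 \<in> verts G"
    using assms by (auto simp: G_def simple_graph_def complete_graph_def)
  have t: "t \<le> card (verts G) - 1" using assms card by simp
  obtain w where w: "w \<ge> 0" "real n * w \<le> 1"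
    "real n * w \<le> real t * real n / real ((n - 2 * r) choose 2)"
    "real t * (1 - real n * w) \<le> real (n - 1 - t) * (real (n - 2 * r) * w)"
    using star_weight_exists[OF assms(2,3)] .
  \<comment> \<open>This one vector lies in both tightenings.\<close>
  define y where "y = moments (stars G) (star_measure G w)"
  let ?Q = "pvc_vars G" and ?C = "pvc_system t G"
  have fQ: "finite ?Q" by (rule finite_pvc_vars[OF G(1)])
  have cone: "moments (stars G) (fix_vars S N (star_measure G w)) \<in> homogenized_cone ?Q ?C"
    if "S \<union> N \<in> subsets_upto ?Q r" for S N
    using w that by (intro star_moments_in_cone[OF G t]) (auto simp: card)
  have nonneg: "star_measure G w T \<ge> 0" for T
    using w by (simp add: star_measure_def card)
  have y0: "y {} = 1"
    by (simp add: y_def moments_stars[OF fV] star_measure_def card)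
  \<comment> \<open>Only the star of \<open>i\<close> contains \<open>Inl i\<close>, so each vertex
    variable has value \<open>w\<close>.\<close>
  have "(\<Sum>i\<in>verts G. y {Inl i}) = (\<Sum>i\<in>verts G. w)"
    using fV unfolding y_def moments_stars[OF fV]
    by (intro sum.cong refl) (simp add: star_measure_def of_bool_def if_distrib cong: if_cong)
  then have obj: "(\<Sum>i\<in>verts G. y {Inl i}) \<le> real t * real n / real ((n - 2 * r) choose 2)"
    using w(3) by (simp add: card)
  \<comment> \<open>A single vertex covers \<open>n - 1 \<ge> t\<close> edges.\<close>
  have cover: "partial_vertex_cover t G {0}"
    using t V0 card_incident_edges[OF G V0] by (simp add: partial_vertex_cover_def Int_commute)
  have gap: "real ((n - 2 * r) choose 2) / (real t * real n) \<le> pvc_integrality_gap t G R"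
    if "y \<in> R" "R \<subseteq> homogenized_cone ?Q ?C \<inter> {x. x {} = 1}" for R
    using integrality_gap_ge[OF G(1) assms(2) cover that(2,1) obj] by simp
  have "y \<in> LS_plus ?Q ?C r"
    using moments_in_LS_plus_cone[OF fQ nonneg cone] y0 by (simp add: LS_plus_def y_def)
  \<comment> \<open>Vertex 0 makes the set of variables nonempty, as
    \<open>LS_plus_cone_subset\<close> requires.\<close>
  moreover have "LS_plus ?Q ?C r \<subseteq> homogenized_cone ?Q ?C \<inter> {x. x {} = 1}"
    using LS_plus_cone_subset[of ?Q ?C r] V0 by (auto simp: LS_plus_def pvc_vars_def)
  moreover have "y \<in> SA_plus ?Q ?C r"
  proof -
    have "SA_moments ?Q ?C r y y"
      unfolding y_def by (rule SA_moments_moments[OF fQ cone])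
    moreover have "psd_on (subsets_upto ?Q 1) (moment_matrix y)"
      unfolding y_def by (rule psd_on_moments) (rule nonneg)
    ultimately show ?thesis
      using y0 unfolding SA_plus_def by blast
  qed
  moreover have "SA_plus ?Q ?C r \<subseteq> homogenized_cone ?Q ?C \<inter> {x. x {} = 1}"
    using SA_plus_subset[of ?Q ?C r] by (auto simp: SA_plus_def)
  ultimately show ?thesis
    using gap G card by blast
qed

end
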